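(* The equivalence class of the category $\Pi(G)$ is a homotopy invariant for finite graphs with no isolated vertices: if $G$ and $H$ are finite graphs with no isolated vertices which are $\times$-homotopy equivalent, then the fundamental groupoids $\Pi(G)$ and $\Pi(H)$ are equivalent categories.
   Context: A graph $G$ is undirected without multiple edges, loops allowed: a vertex set $V(G)$ with a symmetric adjacency relation $\sim$ (edges). A vertex is isolated if it is adjacent to no vertex (a looped vertex is adjacent to itself, hence not isolated). A graph morphism $f: G\to H$ is a map $V(G)\to V(H)$ with $v_1\sim v_2 \Rightarrow f(v_1)\sim f(v_2)$. The product $G\times H$ has vertices $V(G)\times V(H)$, with $(v_1,w_1)\sim(v_2,w_2)$ iff $v_1\sim v_2$ and $w_1\sim w_2$. $P_n$ is the graph on $\{0,\dots,n\}$ whose edges are $i\sim i+1$; $I_n^\ell$ is the graph on $\{0,\dots,n\}$ whose edges are $i\sim i$ and $i\sim i+1$. Morphisms $f,g:G\to H$ are $\times$-homotopic, $f\simeq g$, if for some $n$ there is a morphism $\Lambda:G\times I_n^\ell\to H$ with $\Lambda(\cdot,0)=f$ and $\Lambda(\cdot,n)=g$. Graphs $G,H$ are $\times$-homotopy equivalent if there are morphisms $\phi:G\to H$, $\psi:H\to G$ with $\psi\phi\simeq \mathrm{id}_G$ and $\phi\psi\simeq\mathrm{id}_H$. A walk of length $n\ge0$ in $G$ from $v_0$ to $v_n$ is a morphism $P_n\to G$, written $(v_0v_1\dots v_n)$. Concatenation of $(x v_1\dots v_{n-1}y)$ with $(y w_1\dots w_{m-1}z)$ is $(x v_1\dots v_{n-1}y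 w_1\dots w_{m-1}z)$. If $v_i=v_{i+2}$ in a walk, the prune at $i$ is the walk obtained by deleting the entries $v_i,v_{i+1}$. Two walks $\alpha,\beta$ of length $n$ from $x$ to $y$ are homotopic rel endpoints if there are $m\ge 0$ and a morphism $\Lambda:P_n\times I_m^\ell\to G$ with $\Lambda(\cdot,0)=\alpha$, $\Lambda(\cdot,m)=\beta$, and $\Lambda(0,j)=x$, $\Lambda(n,j)=y$ for all $j$. The fundamental groupoid $\Pi(G)$ has as objects the vertices of $G$; arrows from $v$ to $w$ are equivalence classes of walks from $v$ to $w$ under the equivalence relation generated by prunes and homotopy rel endpoints; composition is induced by concatenation. *)

theory Defs
  imports "Graph_Theory.Pair_Digraph"
begin

section \<open>Graphs\<close>

text \<open>
  An undirected graph without multiple edges, loops allowed, is a \<^typ>\<open>'a pair_pre_digraph\<close> whose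
  arc relation is symmetric: \<open>v \<sim> w\<close> is \<open>(v, w) \<in> parcs G\<close>. The locale
  \<^locale>\<open>pair_pseudo_graph\<close> says that \<open>G\<close> is such a graph and is finite.

  Maps between graphs are total HOL functions; only their values on vertices matter, so equality
  of morphisms is always stated on the vertex set.
\<close>

definition isolated :: "'a pair_pre_digraph \<Rightarrow> 'a \<Rightarrow> bool" where
  "isolated G v \<longleftrightarrow> v \<in> pverts G \<and> (\<nexists>w. (v, w) \<in> parcs G)"

definition graph_morphism ::
  "'a pair_pre_digraph \<Rightarrow> 'b pair_pre_digraph \<Rightarrow> ('a \<Rightarrow> 'b) \<Rightarrow> bool" where
  "graph_morphism G H f \<longleftrightarrow>
     (\<forall>v \<in> pverts G. f v \<in> pverts H) \<and>
     (\<forall>v w. (v, w) \<in> parcs G \<longrightarrow> (f v, f w) \<in> parcs H)"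

definition graph_prod ::
  "'a pair_pre_digraph \<Rightarrow> 'b pair_pre_digraph \<Rightarrow> ('a \<times> 'b) pair_pre_digraph"
  (infixr "\<times>\<^sub>g" 80) where
  "G \<times>\<^sub>g H =
     \<lparr> pverts = pverts G \<times> pverts H,
       parcs = {((v1, w1), (v2, w2)) | v1 w1 v2 w2. (v1, v2) \<in> parcs G \<and> (w1, w2) \<in> parcs H} \<rparr>"

definition path_graph :: "nat \<Rightarrow> nat pair_pre_digraph" where
  "path_graph n =
     \<lparr> pverts = {0..n},
       parcs = {(i, j). i \<le> n \<and> j \<le> n \<and> (j = i + 1 \<or> i = j + 1)} \<rparr>"

definition looped_path_graph :: "nat \<Rightarrow> nat pair_pre_digraph" where
  "looped_path_graph n =
     \<lparr> pverts = {0..n},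
       parcs = {(i, j). i \<le> n \<and> j \<le> n \<and> (j = i \<or> j = i + 1 \<or> i = j + 1)} \<rparr>"

definition times_homotopic ::
  "'a pair_pre_digraph \<Rightarrow> 'b pair_pre_digraph \<Rightarrow> ('a \<Rightarrow> 'b) \<Rightarrow> ('a \<Rightarrow> 'b) \<Rightarrow> bool" where
  "times_homotopic G H f g \<longleftrightarrow>
     graph_morphism G H f \<and> graph_morphism G H g \<and>
     (\<exists>n \<Lambda>. graph_morphism (G \<times>\<^sub>g looped_path_graph n) H \<Lambda> \<and>
        (\<forall>v \<in> pverts G. \<Lambda> (v, 0) = f v \<and> \<Lambda> (v, n) = g v))"

definition times_homotopy_equivalent ::
  "'a pair_pre_digraph \<Rightarrow> 'b pair_pre_digraph \<Rightarrow> bool" where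
  "times_homotopy_equivalent G H \<longleftrightarrow>
     (\<exists>\<phi> \<psi>. graph_morphism G H \<phi> \<and> graph_morphism H G \<psi> \<and>
        times_homotopic G G (\<psi> \<circ> \<phi>) id \<and> times_homotopic H H (\<phi> \<circ> \<psi>) id)"


section \<open>Categories and equivalence of categories\<close>

text \<open>
  Arrows are indexed by their source and target, so hom-sets need not be disjoint.
  \<open>Comp C x y z g f\<close> is the composite \<open>g \<circ> f\<close> of \<open>f : x \<rightarrow> y\<close> and \<open>g : y \<rightarrow> z\<close>.
\<close>

record ('o, 'm) cat =
  Ob :: "'o set"
  Hom :: "'o \<Rightarrow> 'o \<Rightarrow> 'm set"
  Ident :: "'o \<Rightarrow> 'm"
  Comp :: "'o \<Rightarrow> 'o \<Rightarrow> 'o \<Rightarrow> 'm \<Rightarrow> 'm \<Rightarrow> 'm"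

locale category =
  fixes C :: "('o, 'm) cat"
  assumes Ident_in_Hom: "x \<in> Ob C \<Longrightarrow> Ident C x \<in> Hom C x x"
    and Comp_in_Hom:
      "\<lbrakk>x \<in> Ob C; y \<in> Ob C; z \<in> Ob C; f \<in> Hom C x y; g \<in> Hom C y z\<rbrakk>
         \<Longrightarrow> Comp C x y z g f \<in> Hom C x z"
    and Comp_Ident_right:
      "\<lbrakk>x \<in> Ob C; y \<in> Ob C; f \<in> Hom C x y\<rbrakk> \<Longrightarrow> Comp C x x y f (Ident C x) = f"
    and Comp_Ident_left:
      "\<lbrakk>x \<in> Ob C; y \<in> Ob C; f \<in> Hom C x y\<rbrakk> \<Longrightarrow> Comp C x y y (Ident C y) f = f"
    and Comp_assoc:
      "\<lbrakk>w \<in> Ob C; x \<in> Ob C; y \<in> Ob C; z \<in> Ob C;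
        f \<in> Hom C w x; g \<in> Hom C x y; h \<in> Hom C y z\<rbrakk>
         \<Longrightarrow> Comp C w y z h (Comp C w x y g f) = Comp C w x z (Comp C x y z h g) f"

record ('o, 'm, 'p, 'n) cat_map =
  on_ob :: "'o \<Rightarrow> 'p"
  on_arr :: "'o \<Rightarrow> 'o \<Rightarrow> 'm \<Rightarrow> 'n"

definition is_functor :: "('o, 'm) cat \<Rightarrow> ('p, 'n) cat \<Rightarrow> ('o, 'm, 'p, 'n) cat_map \<Rightarrow> bool" where
  "is_functor C D F \<longleftrightarrow>
     (\<forall>x \<in> Ob C. on_ob F x \<in> Ob D) \<and>
     (\<forall>x \<in> Ob C. \<forall>y \<in> Ob C. \<forall>f \<in> Hom C x y.
        on_arr F x y f \<in> Hom D (on_ob F x) (on_ob F y)) \<and>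
     (\<forall>x \<in> Ob C. on_arr F x x (Ident C x) = Ident D (on_ob F x)) \<and>
     (\<forall>x \<in> Ob C. \<forall>y \<in> Ob C. \<forall>z \<in> Ob C. \<forall>f \<in> Hom C x y. \<forall>g \<in> Hom C y z.
        on_arr F x z (Comp C x y z g f) =
          Comp D (on_ob F x) (on_ob F y) (on_ob F z) (on_arr F y z g) (on_arr F x y f))"

definition id_functor :: "('o, 'm, 'o, 'm) cat_map" where
  "id_functor = \<lparr> on_ob = (\<lambda>x. x), on_arr = (\<lambda>x y f. f) \<rparr>"

definition comp_functor ::
  "('p, 'n, 'q, 'k) cat_map \<Rightarrow> ('o, 'm, 'p, 'n) cat_map \<Rightarrow> ('o, 'm, 'q, 'k) cat_map" where
  "comp_functor K F =
     \<lparr> on_ob = (\<lambda>x. on_ob K (on_ob F x)),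
       on_arr = (\<lambda>x y f. on_arr K (on_ob F x) (on_ob F y) (on_arr F x y f)) \<rparr>"

definition is_iso :: "('o, 'm) cat \<Rightarrow> 'o \<Rightarrow> 'o \<Rightarrow> 'm \<Rightarrow> bool" where
  "is_iso C x y f \<longleftrightarrow>
     f \<in> Hom C x y \<and>
     (\<exists>g \<in> Hom C y x. Comp C x y x g f = Ident C x \<and> Comp C y x y f g = Ident C y)"

definition natural_isomorphism ::
  "('o, 'm) cat \<Rightarrow> ('p, 'n) cat \<Rightarrow> ('o, 'm, 'p, 'n) cat_map \<Rightarrow> ('o, 'm, 'p, 'n) cat_map
     \<Rightarrow> ('o \<Rightarrow> 'n) \<Rightarrow> bool" where
  "natural_isomorphism C D F K \<eta> \<longleftrightarrow>
     (\<forall>x \<in> Ob C. is_iso D (on_ob F x) (on_ob K x) (\<eta> x)) \<and>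
     (\<forall>x \<in> Ob C. \<forall>y \<in> Ob C. \<forall>f \<in> Hom C x y.
        Comp D (on_ob F x) (on_ob F y) (on_ob K y) (\<eta> y) (on_arr F x y f) =
        Comp D (on_ob F x) (on_ob K x) (on_ob K y) (on_arr K x y f) (\<eta> x))"

definition equivalent_categories :: "('o, 'm) cat \<Rightarrow> ('p, 'n) cat \<Rightarrow> bool" where
  "equivalent_categories C D \<longleftrightarrow>
     category C \<and> category D \<and>
     (\<exists>F K \<eta> \<epsilon>. is_functor C D F \<and> is_functor D C K \<and>
        natural_isomorphism C C id_functor (comp_functor K F) \<eta> \<and>
        natural_isomorphism D D (comp_functor F K) id_functor \<epsilon>)"


section \<open>Walks and the fundamental groupoid\<close>

text \<open>
  A walk \<open>(v\<^sub>0 v\<^sub>1 \<dots> v\<^sub>n)\<close> of length \<open>n\<close>, i.e. a morphism from \<open>path_graph n\<close> to \<open>G\<close>, is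
  represented by the list of its \<open>n + 1\<close> values.
\<close>

definition is_walk :: "'a pair_pre_digraph \<Rightarrow> nat \<Rightarrow> 'a list \<Rightarrow> bool" where
  "is_walk G n \<alpha> \<longleftrightarrow> length \<alpha> = n + 1 \<and> graph_morphism (path_graph n) G (\<lambda>i. \<alpha> ! i)"

definition walks :: "'a pair_pre_digraph \<Rightarrow> 'a \<Rightarrow> 'a \<Rightarrow> 'a list set" where
  "walks G x y = {\<alpha>. \<exists>n. is_walk G n \<alpha> \<and> \<alpha> ! 0 = x \<and> \<alpha> ! n = y}"

definition walk_concat :: "'a list \<Rightarrow> 'a list \<Rightarrow> 'a list" where
  "walk_concat \<alpha> \<beta> = \<alpha> @ tl \<beta>"

definition prunes_to :: "'a list \<Rightarrow> 'a list \<Rightarrow> bool" where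
  "prunes_to \<alpha> \<beta> \<longleftrightarrow>
     (\<exists>i. i + 2 < length \<alpha> \<and> \<alpha> ! i = \<alpha> ! (i + 2) \<and> \<beta> = take i \<alpha> @ drop (i + 2) \<alpha>)"

definition homotopic_rel_endpoints ::
  "'a pair_pre_digraph \<Rightarrow> 'a \<Rightarrow> 'a \<Rightarrow> 'a list \<Rightarrow> 'a list \<Rightarrow> bool" where
  "homotopic_rel_endpoints G x y \<alpha> \<beta> \<longleftrightarrow>
     (\<exists>n m \<Lambda>. length \<alpha> = n + 1 \<and> length \<beta> = n + 1 \<and>
        graph_morphism (path_graph n \<times>\<^sub>g looped_path_graph m) G \<Lambda> \<and>
        (\<forall>i \<le> n. \<Lambda> (i, 0) = \<alpha> ! i) \<and> (\<forall>i \<le> n. \<Lambda> (i, m) = \<beta> ! i) \<and>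
        (\<forall>j \<le> m. \<Lambda> (0, j) = x \<and> \<Lambda> (n, j) = y))"

definition walk_step :: "'a pair_pre_digraph \<Rightarrow> 'a \<Rightarrow> 'a \<Rightarrow> 'a list \<Rightarrow> 'a list \<Rightarrow> bool" where
  "walk_step G x y \<alpha> \<beta> \<longleftrightarrow>
     \<alpha> \<in> walks G x y \<and> \<beta> \<in> walks G x y \<and>
     (prunes_to \<alpha> \<beta> \<or> homotopic_rel_endpoints G x y \<alpha> \<beta>)"

definition walk_rel :: "'a pair_pre_digraph \<Rightarrow> 'a \<Rightarrow> 'a \<Rightarrow> 'a list rel" where
  "walk_rel G x y =
     {(\<alpha>, \<beta>). \<alpha> \<in> walks G x y \<and> \<beta> \<in> walks G x y \<and> equivclp (walk_step G x y) \<alpha> \<beta>}"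

text \<open>
  Composition of arrows is lifted from concatenation to equivalence classes; since \<open>walk_concat\<close>
  respects \<open>walk_rel\<close>, the union below is the single class of any concatenation of
  representatives.
\<close>

definition fundamental_groupoid :: "'a pair_pre_digraph \<Rightarrow> ('a, 'a list set) cat" where
  "fundamental_groupoid G =
     \<lparr> Ob = pverts G,
       Hom = (\<lambda>x y. walks G x y // walk_rel G x y),
       Ident = (\<lambda>x. walk_rel G x x `` {[x]}),
       Comp = (\<lambda>x y z B A. \<Union>\<alpha> \<in> A. \<Union>\<beta> \<in> B. walk_rel G x z `` {walk_concat \<alpha> \<beta>}) \<rparr>"

end

theory Submission
  imports Defs
begin

text \<open>
  Since \<open>I\<^sub>n\<close> is looped, each time slice of a homotopy is itself a morphism, and consecutive
  slices \<open>f\<close>, \<open>g\<close> satisfy \<open>f v \<sim> g w\<close> whenever \<open>v \<sim> w\<close>.  For such a pair, choosing a neighbour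
  \<open>w\<close> of each \<open>v\<close>, the classes of the walks \<open>(f v, f w, g v)\<close> form a natural transformation between
  the induced functors: changing one interior vertex of a walk is a homotopy rel endpoints, and two
  such changes give the naturality square of an edge.  Every walk is inverted by its reversal, by
  pruning, so these transformations are isomorphisms.  Composing them along a homotopy
  \<open>\<psi>\<phi> \<simeq> id\<close> shows that \<open>\<phi>\<close> and \<open>\<psi>\<close> induce mutually inverse equivalences.
\<close>

section \<open>Walks as lists\<close>

context pair_sym_digraph
begin

lemma arc_sym: "(v, w) \<in> parcs G \<Longrightarrow> (w, v) \<in> parcs G"
  using pair_sym_arcs by (auto simp: symmetric_def sym_def)

text \<open>\<open>path_graph\<close> has its arcs in both directions while
  \<open>successively\<close> checks only the forward ones; symmetry of the graph closes the gap. In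
  list form a walk splits along \<open>@\<close>, which suits concatenation, reversal and
  pruning.\<close>

lemma walks_iff:
  "\<alpha> \<in> walks G x y \<longleftrightarrow>
     \<alpha> \<noteq> [] \<and> hd \<alpha> = x \<and> last \<alpha> = y \<and> set \<alpha> \<subseteq> pverts G \<and>
     successively (\<lambda>v w. (v, w) \<in> parcs G) \<alpha>"
proof -
  have "graph_morphism (path_graph n) G (\<lambda>i. \<alpha> ! i) \<longleftrightarrow>
      set \<alpha> \<subseteq> pverts G \<and> successively (\<lambda>v w. (v, w) \<in> parcs G) \<alpha>" if "length \<alpha> = n + 1" for n
    using that arc_sym
    by (fastforce simp: graph_morphism_def path_graph_def successively_conv_nth set_conv_nth less_Suc_eq_le)
  then show ?thesis
    unfolding walks_def is_walk_def
    by (cases \<alpha>) (auto simp: hd_conv_nth last_conv_nth)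
qed

lemma walks_ends_in_verts:
  assumes "\<alpha> \<in> walks G x y"
  shows "x \<in> pverts G" "y \<in> pverts G"
  using assms by (auto simp: walks_iff)

lemma walk_concat_in_walks:
  assumes "\<alpha> \<in> walks G x y" "\<beta> \<in> walks G y z"
  shows "walk_concat \<alpha> \<beta> \<in> walks G x z"
  using assms
  by (cases \<beta>) (auto simp: walks_iff walk_concat_def successively_append_iff successively_Cons)

lemma rev_in_walks: "\<alpha> \<in> walks G x y \<Longrightarrow> rev \<alpha> \<in> walks G y x"
  by (auto simp: walks_iff hd_rev last_rev arc_sym elim: successively_mono)

lemma map_in_walks:
  assumes "pair_sym_digraph H" "graph_morphism G H f" "\<alpha> \<in> walks G x y"
  shows "map f \<alpha> \<in> walks H (f x) (f y)"
  using assms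
  by (auto simp: walks_iff pair_sym_digraph.walks_iff graph_morphism_def hd_map last_map
      successively_map elim!: successively_mono)

end

text \<open>Nonemptiness of \<beta> makes the outer \<open>tl\<close> on the right remove the head
  of \<beta>; for \<open>\<beta> = []\<close> it would remove a second entry of \<gamma>.\<close>

lemma walk_concat_assoc:
  "\<beta> \<noteq> [] \<Longrightarrow> walk_concat (walk_concat \<alpha> \<beta>) \<gamma> = walk_concat \<alpha> (walk_concat \<beta> \<gamma>)"
  by (simp add: walk_concat_def)

lemma map_walk_concat: "map f (walk_concat \<alpha> \<beta>) = walk_concat (map f \<alpha>) (map f \<beta>)"
  by (simp add: walk_concat_def map_tl)

lemma walk_concat_singleton_right: "walk_concat \<alpha> [y] = \<alpha>"
  by (simp add: walk_concat_def)

lemma (in pair_sym_digraph) walk_concat_singleton_left: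
  "\<alpha> \<in> walks G x y \<Longrightarrow> walk_concat [x] \<alpha> = \<alpha>"
  by (cases \<alpha>) (auto simp: walk_concat_def walks_iff)


section \<open>Prunes and homotopies\<close>

text \<open>This form has no indices: the context p, q can be mapped or enlarged freely, so prunes
  are seen at once to survive \<open>map\<close> and \<open>append\<close>.\<close>

lemma prunes_to_iff:
  "prunes_to \<alpha> \<beta> \<longleftrightarrow> (\<exists>p a b q. \<alpha> = p @ [a, b, a] @ q \<and> \<beta> = p @ [a] @ q)"
proof
  assume "prunes_to \<alpha> \<beta>"
  then obtain i where i: "i + 2 < length \<alpha>" "\<alpha> ! i = \<alpha> ! (i + 2)"
    "\<beta> = take i \<alpha> @ drop (i + 2) \<alpha>"
    by (auto simp: prunes_to_def)
  \<comment> \<open>Of the two equal entries at i and i + 2 the prune deletes the first, so what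
    remains starts with the same vertex.\<close>
  have "drop (i + 2) \<alpha> = \<alpha> ! i # drop (i + 3) \<alpha>"
    using Cons_nth_drop_Suc[OF i(1)] i(2) by (simp add: numeral_eq_Suc)
  moreover have "\<alpha> = take i \<alpha> @ \<alpha> ! i # \<alpha> ! (i + 1) # drop (i + 2) \<alpha>"
    using i(1) by (simp add: Cons_nth_drop_Suc id_take_nth_drop[symmetric])
  ultimately have "\<alpha> = take i \<alpha> @ [\<alpha> ! i, \<alpha> ! (i + 1), \<alpha> ! i] @ drop (i + 3) \<alpha>"
    "\<beta> = take i \<alpha> @ [\<alpha> ! i] @ drop (i + 3) \<alpha>"
    using i(3) by auto
  then show "\<exists>p a b q. \<alpha> = p @ [a, b, a] @ q \<and> \<beta> = p @ [a] @ q"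
    by blast
next
  assume "\<exists>p a b q. \<alpha> = p @ [a, b, a] @ q \<and> \<beta> = p @ [a] @ q"
  then obtain p a b q where "\<alpha> = p @ [a, b, a] @ q" "\<beta> = p @ [a] @ q"
    by blast
  then show "prunes_to \<alpha> \<beta>"
    unfolding prunes_to_def by (intro exI[of _ "length p"]) (auto simp: nth_append)
qed

lemma prunes_to_map: "prunes_to \<alpha> \<beta> \<Longrightarrow> prunes_to (map f \<alpha>) (map f \<beta>)"
  unfolding prunes_to_iff by fastforce

lemma prunes_to_append: "prunes_to \<alpha> \<beta> \<Longrightarrow> prunes_to (\<gamma> @ \<alpha> @ \<delta>) (\<gamma> @ \<beta> @ \<delta>)"
proof -
  assume "prunes_to \<alpha> \<beta>"
  then obtain p a b q where "\<alpha> = p @ [a, b, a] @ q" "\<beta> = p @ [a] @ q"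
    unfolding prunes_to_iff by blast
  then have "\<gamma> @ \<alpha> @ \<delta> = (\<gamma> @ p) @ [a, b, a] @ (q @ \<delta>)" "\<gamma> @ \<beta> @ \<delta> = (\<gamma> @ p) @ [a] @ (q @ \<delta>)"
    by simp_all
  then show ?thesis
    unfolding prunes_to_iff by blast
qed

lemma prunes_to_walk_concat_left:
  assumes "prunes_to \<alpha> \<beta>" "\<gamma> \<noteq> []" "last \<gamma> = hd \<alpha>"
  shows "prunes_to (walk_concat \<gamma> \<alpha>) (walk_concat \<gamma> \<beta>)"
proof -
  have "hd \<beta> = hd \<alpha>" "\<alpha> \<noteq> []" "\<beta> \<noteq> []"
    using assms(1) by (auto simp: prunes_to_iff hd_append)
  \<comment> \<open>The shared vertex is removed from \<gamma> instead of \<alpha>. The prune may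
    use the first vertex of \<alpha>, so \<alpha> must stay whole; a prune keeps the head, so the
    same works for \<beta>.\<close>
  then have "walk_concat \<gamma> \<alpha> = butlast \<gamma> @ \<alpha> @ []" "walk_concat \<gamma> \<beta> = butlast \<gamma> @ \<beta> @ []"
    using assms(2,3) by (cases \<gamma> rule: rev_cases; cases \<alpha>; cases \<beta>; simp add: walk_concat_def)+
  with prunes_to_append[OF assms(1), of "butlast \<gamma>" "[]"] show ?thesis
    by simp
qed

lemma prunes_to_walk_concat_right:
  "prunes_to \<alpha> \<beta> \<Longrightarrow> prunes_to (walk_concat \<alpha> \<delta>) (walk_concat \<beta> \<delta>)"
  using prunes_to_append[of \<alpha> \<beta> "[]"] by (simp add: walk_concat_def)

text \<open>The path has no loops, so every arc of the product changes the path coordinate by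
  exactly one. Both orientations of the arcs from column i to column i + 1 therefore cover all
  arcs.\<close>

lemma graph_morphism_path_prodI:
  assumes "\<And>i j. i \<le> n \<Longrightarrow> j \<le> m \<Longrightarrow> \<Lambda> (i, j) \<in> pverts G"
    and "\<And>i j k. i < n \<Longrightarrow> j \<le> m \<Longrightarrow> k \<le> m \<Longrightarrow> j = k \<or> j = k + 1 \<or> k = j + 1 \<Longrightarrow>
      (\<Lambda> (i, j), \<Lambda> (i + 1, k)) \<in> parcs G \<and> (\<Lambda> (i + 1, k), \<Lambda> (i, j)) \<in> parcs G"
  shows "graph_morphism (path_graph n \<times>\<^sub>g looped_path_graph m) G \<Lambda>"
  unfolding graph_morphism_def graph_prod_def path_graph_def looped_path_graph_def
proof (intro conjI ballI allI impI, goal_cases)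
  case (1 v)
  then show ?case using assms(1) by auto
next
  case (2 v w)
  then obtain i j i' j' where *: "v = (i, j)" "w = (i', j')" "i \<le> n" "i' \<le> n" "j \<le> m" "j' \<le> m"
    "i' = i + 1 \<or> i = i' + 1" "j' = j \<or> j' = j + 1 \<or> j = j' + 1"
    by auto
  show ?case
  proof (cases "i' = i + 1")
    case True
    then show ?thesis using assms(2)[of i j j'] * by auto
  next
    case False
    then show ?thesis using assms(2)[of i' j' j] * by auto
  qed
qed

lemma graph_morphism_path_prodD:
  assumes "graph_morphism (path_graph n \<times>\<^sub>g looped_path_graph m) G \<Lambda>"
  shows "i \<le> n \<Longrightarrow> j \<le> m \<Longrightarrow> \<Lambda> (i, j) \<in> pverts G"
    and "i < n \<Longrightarrow> j \<le> m \<Longrightarrow> k \<le> m \<Longrightarrow> j = k \<or> j = k + 1 \<or> k = j + 1 \<Longrightarrow>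
      (\<Lambda> (i, j), \<Lambda> (i + 1, k)) \<in> parcs G \<and> (\<Lambda> (i + 1, k), \<Lambda> (i, j)) \<in> parcs G"
  using assms
  unfolding graph_morphism_def graph_prod_def path_graph_def looped_path_graph_def
  by auto

section \<open>Homotopies rel endpoints under morphisms, concatenation and change of one
  vertex\<close>

lemma homotopic_rel_endpoints_map:
  assumes "graph_morphism G H f" "homotopic_rel_endpoints G x y \<alpha> \<beta>"
  shows "homotopic_rel_endpoints H (f x) (f y) (map f \<alpha>) (map f \<beta>)"
proof -
  obtain n m \<Lambda> where \<Lambda>: "length \<alpha> = n + 1" "length \<beta> = n + 1"
    "graph_morphism (path_graph n \<times>\<^sub>g looped_path_graph m) G \<Lambda>"
    "\<forall>i \<le> n. \<Lambda> (i, 0) = \<alpha> ! i" "\<forall>i \<le> n. \<Lambda> (i, m) = \<beta> ! i"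
    "\<forall>j \<le> m. \<Lambda> (0, j) = x \<and> \<Lambda> (n, j) = y"
    using assms(2) unfolding homotopic_rel_endpoints_def by blast
  have "graph_morphism (path_graph n \<times>\<^sub>g looped_path_graph m) H (f \<circ> \<Lambda>)"
    using assms(1) \<Lambda>(3) unfolding graph_morphism_def by auto
  then show ?thesis
    unfolding homotopic_rel_endpoints_def using \<Lambda>
    by (intro exI[of _ n] exI[of _ m] exI[of _ "f \<circ> \<Lambda>"]) auto
qed

context pair_sym_digraph
begin

lemma walks_nth:
  assumes "\<alpha> \<in> walks G x y"
  obtains k where "length \<alpha> = k + 1" "\<alpha> ! 0 = x" "\<alpha> ! k = y"
    "\<And>i. i \<le> k \<Longrightarrow> \<alpha> ! i \<in> pverts G"
    "\<And>i. i < k \<Longrightarrow> (\<alpha> ! i, \<alpha> ! (i + 1)) \<in> parcs G \<and> (\<alpha> ! (i + 1), \<alpha> ! i) \<in> parcs G"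
proof -
  obtain k where k: "length \<alpha> = k + 1" "\<alpha> ! 0 = x" "\<alpha> ! k = y"
    using assms by (auto simp: walks_def is_walk_def)
  moreover have "\<alpha> ! i \<in> pverts G" if "i \<le> k" for i
    using assms that k by (auto simp: walks_iff)
  moreover have "(\<alpha> ! i, \<alpha> ! (i + 1)) \<in> parcs G" if "i < k" for i
    using assms that k by (auto simp: walks_iff successively_conv_nth)
  ultimately show thesis
    using that arc_sym by blast
qed

text \<open>The homotopy is continued by \<delta>, held constant in time. The two pieces fit because
  the endpoint y never moves.\<close>

lemma homotopic_rel_endpoints_walk_concat_right:
  assumes "homotopic_rel_endpoints G x y \<alpha> \<beta>" "\<delta> \<in> walks G y z"
  shows "homotopic_rel_endpoints G x z (walk_concat \<alpha> \<delta>) (walk_concat \<beta> \<delta>)"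
proof -
  obtain n m \<Lambda> where \<Lambda>: "length \<alpha> = n + 1" "length \<beta> = n + 1"
    "graph_morphism (path_graph n \<times>\<^sub>g looped_path_graph m) G \<Lambda>"
    "\<forall>i \<le> n. \<Lambda> (i, 0) = \<alpha> ! i" "\<forall>i \<le> n. \<Lambda> (i, m) = \<beta> ! i"
    "\<forall>j \<le> m. \<Lambda> (0, j) = x \<and> \<Lambda> (n, j) = y"
    using assms(1) unfolding homotopic_rel_endpoints_def by blast
  obtain k where k: "length \<delta> = k + 1" "\<delta> ! 0 = y" "\<delta> ! k = z"
    "\<And>i. i \<le> k \<Longrightarrow> \<delta> ! i \<in> pverts G"
    "\<And>i. i < k \<Longrightarrow> (\<delta> ! i, \<delta> ! (i + 1)) \<in> parcs G \<and> (\<delta> ! (i + 1), \<delta> ! i) \<in> parcs G"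
    using walks_nth[OF assms(2)] by blast
  define \<Lambda>' where "\<Lambda>' = (\<lambda>(i, j). if i \<le> n then \<Lambda> (i, j) else \<delta> ! (i - n))"
  have low: "\<Lambda>' (i, j) = \<Lambda> (i, j)" if "i \<le> n" for i j
    using that by (simp add: \<Lambda>'_def)
  \<comment> \<open>At the seam column n both descriptions give y. Hence columns i and i + 1 always
    lie together in one piece: the old homotopy for i < n, and \<delta> otherwise.\<close>
  have high: "\<Lambda>' (i, j) = \<delta> ! (i - n)" if "n \<le> i" "j \<le> m" for i j
    using that k \<Lambda>(6) by (cases "i = n") (auto simp: \<Lambda>'_def)
  have concat_nth: "walk_concat \<gamma> \<delta> ! i = (if i \<le> n then \<gamma> ! i else \<delta> ! (i - n))"
    if "length \<gamma> = n + 1" "i \<le> n + k" for \<gamma> i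
    using that k(1) by (auto simp: walk_concat_def nth_append nth_tl Suc_diff_Suc)
  have "graph_morphism (path_graph (n + k) \<times>\<^sub>g looped_path_graph m) G \<Lambda>'"
  proof (rule graph_morphism_path_prodI, goal_cases)
    case (1 i j)
    then show ?case
      using graph_morphism_path_prodD(1)[OF \<Lambda>(3)] k(4)[of "i - n"] by (auto simp: \<Lambda>'_def)
  next
    case (2 i j l)
    show ?case
    proof (cases "i < n")
      case True
      then show ?thesis
        using 2 graph_morphism_path_prodD(2)[OF \<Lambda>(3), of i j l] by (simp add: low)
    next
      case False
      then show ?thesis
        using 2 k(5)[of "i - n"] by (simp add: high Suc_diff_le)
    qed
  qed
  moreover have "length (walk_concat \<alpha> \<delta>) = n + k + 1" "length (walk_concat \<beta> \<delta>) = n + k + 1"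
    using \<Lambda> k by (auto simp: walk_concat_def)
  moreover have "\<forall>i \<le> n + k. \<Lambda>' (i, 0) = walk_concat \<alpha> \<delta> ! i"
    "\<forall>i \<le> n + k. \<Lambda>' (i, m) = walk_concat \<beta> \<delta> ! i"
    using \<Lambda> by (auto simp: concat_nth \<Lambda>'_def)
  moreover have "\<forall>j \<le> m. \<Lambda>' (0, j) = x \<and> \<Lambda>' (n + k, j) = z"
    using \<Lambda>(6) k(3) by (auto simp: low high)
  ultimately show ?thesis
    unfolding homotopic_rel_endpoints_def by blast
qed

text \<open>Mirror image of the previous gluing: \<gamma>, constant in time, comes first, and the
  seam column k carries the fixed endpoint x.\<close>

lemma homotopic_rel_endpoints_walk_concat_left:
  assumes "homotopic_rel_endpoints G x y \<alpha> \<beta>" "\<gamma> \<in> walks G w x"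
  shows "homotopic_rel_endpoints G w y (walk_concat \<gamma> \<alpha>) (walk_concat \<gamma> \<beta>)"
proof -
  obtain n m \<Lambda> where \<Lambda>: "length \<alpha> = n + 1" "length \<beta> = n + 1"
    "graph_morphism (path_graph n \<times>\<^sub>g looped_path_graph m) G \<Lambda>"
    "\<forall>i \<le> n. \<Lambda> (i, 0) = \<alpha> ! i" "\<forall>i \<le> n. \<Lambda> (i, m) = \<beta> ! i"
    "\<forall>j \<le> m. \<Lambda> (0, j) = x \<and> \<Lambda> (n, j) = y"
    using assms(1) unfolding homotopic_rel_endpoints_def by blast
  obtain k where k: "length \<gamma> = k + 1" "\<gamma> ! 0 = w" "\<gamma> ! k = x"
    "\<And>i. i \<le> k \<Longrightarrow> \<gamma> ! i \<in> pverts G"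
    "\<And>i. i < k \<Longrightarrow> (\<gamma> ! i, \<gamma> ! (i + 1)) \<in> parcs G \<and> (\<gamma> ! (i + 1), \<gamma> ! i) \<in> parcs G"
    using walks_nth[OF assms(2)] by blast
  define \<Lambda>' where "\<Lambda>' = (\<lambda>(i, j). if i \<le> k then \<gamma> ! i else \<Lambda> (i - k, j))"
  have low: "\<Lambda>' (i, j) = \<gamma> ! i" if "i \<le> k" for i j
    using that by (simp add: \<Lambda>'_def)
  have high: "\<Lambda>' (i, j) = \<Lambda> (i - k, j)" if "k \<le> i" "j \<le> m" for i j
    using that k \<Lambda>(6) by (cases "i = k") (auto simp: \<Lambda>'_def)
  have concat_nth: "walk_concat \<gamma> \<delta> ! i = (if i \<le> k then \<gamma> ! i else \<delta> ! (i - k))"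
    if "length \<delta> = n + 1" "i \<le> k + n" for \<delta> i
    using that k(1) by (auto simp: walk_concat_def nth_append nth_tl Suc_diff_Suc)
  have "graph_morphism (path_graph (k + n) \<times>\<^sub>g looped_path_graph m) G \<Lambda>'"
  proof (rule graph_morphism_path_prodI, goal_cases)
    case (1 i j)
    then show ?case
      using graph_morphism_path_prodD(1)[OF \<Lambda>(3), of "i - k" j] k(4)[of i] by (auto simp: \<Lambda>'_def)
  next
    case (2 i j l)
    show ?case
    proof (cases "i < k")
      case True
      then show ?thesis
        using 2 k(5)[of i] by (simp add: low)
    next
      case False
      then show ?thesis
        using 2 graph_morphism_path_prodD(2)[OF \<Lambda>(3), of "i - k" j l]
        by (simp add: high Suc_diff_le)
    qed
  qed
  moreover have "length (walk_concat \<gamma> \<alpha>) = k + n + 1" "length (walk_concat \<gamma> \<beta>) = k + n + 1"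
    using \<Lambda> k by (auto simp: walk_concat_def)
  moreover have "\<forall>i \<le> k + n. \<Lambda>' (i, 0) = walk_concat \<gamma> \<alpha> ! i"
    "\<forall>i \<le> k + n. \<Lambda>' (i, m) = walk_concat \<gamma> \<beta> ! i"
    using \<Lambda> by (auto simp: concat_nth \<Lambda>'_def)
  moreover have "\<forall>j \<le> m. \<Lambda>' (0, j) = w \<and> \<Lambda>' (k + n, j) = y"
    using \<Lambda>(6) k(2) by (auto simp: low high)
  ultimately show ?thesis
    unfolding homotopic_rel_endpoints_def by blast
qed

text \<open>The two walks themselves are the only slices of a homotopy with m = 1. The bounds on k
  make the changed vertex interior, so the endpoints stay fixed.\<close>

lemma homotopic_rel_endpoints_list_update:
  assumes "\<alpha> \<in> walks G x y" "\<alpha>[k := v] \<in> walks G x y" "0 < k" "k + 1 < length \<alpha>"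
  shows "homotopic_rel_endpoints G x y \<alpha> (\<alpha>[k := v])"
proof -
  let ?\<beta> = "\<alpha>[k := v]"
  obtain n where n: "length \<alpha> = n + 1" "\<alpha> ! 0 = x" "\<alpha> ! n = y"
    "\<And>i. i \<le> n \<Longrightarrow> \<alpha> ! i \<in> pverts G"
    "\<And>i. i < n \<Longrightarrow> (\<alpha> ! i, \<alpha> ! (i + 1)) \<in> parcs G \<and> (\<alpha> ! (i + 1), \<alpha> ! i) \<in> parcs G"
    using walks_nth[OF assms(1)] by blast
  obtain n' where n': "length ?\<beta> = n' + 1" "?\<beta> ! 0 = x" "?\<beta> ! n' = y"
    "\<And>i. i \<le> n' \<Longrightarrow> ?\<beta> ! i \<in> pverts G"
    "\<And>i. i < n' \<Longrightarrow> (?\<beta> ! i, ?\<beta> ! (i + 1)) \<in> parcs G \<and> (?\<beta> ! (i + 1), ?\<beta> ! i) \<in> parcs G"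
    using walks_nth[OF assms(2)] by blast
  have [simp]: "n' = n"
    using n(1) n'(1) by simp
  define \<Lambda> where "\<Lambda> = (\<lambda>(i, j :: nat). if j = 0 then \<alpha> ! i else ?\<beta> ! i)"
  have "graph_morphism (path_graph n \<times>\<^sub>g looped_path_graph 1) G \<Lambda>"
  proof (rule graph_morphism_path_prodI, goal_cases)
    case (1 i j)
    then show ?case using n(4) n'(4) by (auto simp: \<Lambda>_def)
  next
    case (2 i j l)
    \<comment> \<open>Of two consecutive columns at least one is the same in both walks. So an arc
      between different times is already an arc of one of the walks, chosen by the time in the other
      column.\<close>
    show ?case
    proof (cases "i = k")
      case True
      then have "\<alpha> ! (i + 1) = ?\<beta> ! (i + 1)" by simp
      then show ?thesis using n(5)[of i] n'(5)[of i] 2(1) by (simp add: \<Lambda>_def)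
    next
      case False
      then have "\<alpha> ! i = ?\<beta> ! i" by simp
      then show ?thesis using n(5)[of i] n'(5)[of i] 2(1) by (simp add: \<Lambda>_def)
    qed
  qed
  then show ?thesis
    unfolding homotopic_rel_endpoints_def using n n' assms(3,4)
    by (intro exI[of _ n] exI[of _ 1] exI[of _ \<Lambda>]) (auto simp: \<Lambda>_def)
qed

end


section \<open>The congruence on walks\<close>

lemma equiv_walk_rel: "equiv (walks G x y) (walk_rel G x y)"
  by (intro equivI refl_onI symI transI)
    (auto simp: walk_rel_def intro: equivclp_sym equivclp_trans)

lemma walk_relD:
  assumes "(\<alpha>, \<beta>) \<in> walk_rel G x y"
  shows "\<alpha> \<in> walks G x y" "\<beta> \<in> walks G x y"
  using assms by (auto simp: walk_rel_def)

lemma walk_rel_refl: "\<alpha> \<in> walks G x y \<Longrightarrow> (\<alpha>, \<alpha>) \<in> walk_rel G x y"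
  by (simp add: walk_rel_def)

lemma walk_rel_sym: "(\<alpha>, \<beta>) \<in> walk_rel G x y \<Longrightarrow> (\<beta>, \<alpha>) \<in> walk_rel G x y"
  by (auto simp: walk_rel_def intro: equivclp_sym)

lemma walk_rel_trans [trans]:
  "(\<alpha>, \<beta>) \<in> walk_rel G x y \<Longrightarrow> (\<beta>, \<gamma>) \<in> walk_rel G x y \<Longrightarrow> (\<alpha>, \<gamma>) \<in> walk_rel G x y"
  by (auto simp: walk_rel_def intro: equivclp_trans)

lemma walk_step_imp_walk_rel: "walk_step G x y \<alpha> \<beta> \<Longrightarrow> (\<alpha>, \<beta>) \<in> walk_rel G x y"
  by (auto simp: walk_rel_def walk_step_def intro: r_into_equivclp)

text \<open>An operation that preserves the generating steps preserves the equivalence they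
  generate; the hypothesis on \<open>walks\<close> settles the empty chain. Concatenation on either
  side and induced maps are all instances.\<close>

lemma walk_rel_mapI:
  assumes step: "\<And>\<alpha> \<beta>. walk_step G x y \<alpha> \<beta> \<Longrightarrow> walk_step H x' y' (F \<alpha>) (F \<beta>)"
    and walks: "\<And>\<alpha>. \<alpha> \<in> walks G x y \<Longrightarrow> F \<alpha> \<in> walks H x' y'"
    and rel: "(\<alpha>, \<beta>) \<in> walk_rel G x y"
  shows "(F \<alpha>, F \<beta>) \<in> walk_rel H x' y'"
proof -
  have "equivclp (walk_step G x y) \<alpha> \<beta>" "\<alpha> \<in> walks G x y"
    using rel by (auto simp: walk_rel_def)
  then show ?thesis
  proof (induction rule: equivclp_induct)
    case base
    then show ?case by (simp add: walks walk_rel_refl)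
  next
    case (step \<beta> \<gamma>)
    then show ?case
      using assms(1) by (meson walk_rel_sym walk_rel_trans walk_step_imp_walk_rel)
  qed
qed

context pair_sym_digraph
begin

lemma walk_rel_concat_left:
  assumes "(\<alpha>, \<beta>) \<in> walk_rel G x y" "\<gamma> \<in> walks G w x"
  shows "(walk_concat \<gamma> \<alpha>, walk_concat \<gamma> \<beta>) \<in> walk_rel G w y"
proof (rule walk_rel_mapI[OF _ _ assms(1)])
  show "walk_concat \<gamma> \<alpha> \<in> walks G w y" if "\<alpha> \<in> walks G x y" for \<alpha>
    using that assms(2) by (rule walk_concat_in_walks[rotated])
  show "walk_step G w y (walk_concat \<gamma> \<alpha>) (walk_concat \<gamma> \<beta>)" if "walk_step G x y \<alpha> \<beta>" for \<alpha> \<beta>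
    using that assms(2) homotopic_rel_endpoints_walk_concat_left
    by (auto simp: walk_step_def walk_concat_in_walks)
      (auto simp: walks_iff intro: prunes_to_walk_concat_left)
qed

lemma walk_rel_concat_right:
  assumes "(\<alpha>, \<beta>) \<in> walk_rel G x y" "\<delta> \<in> walks G y z"
  shows "(walk_concat \<alpha> \<delta>, walk_concat \<beta> \<delta>) \<in> walk_rel G x z"
proof (rule walk_rel_mapI[OF _ _ assms(1), of _ _ _ "\<lambda>\<alpha>. walk_concat \<alpha> \<delta>"])
  show "walk_concat \<alpha> \<delta> \<in> walks G x z" if "\<alpha> \<in> walks G x y" for \<alpha>
    using that assms(2) by (rule walk_concat_in_walks)
  show "walk_step G x z (walk_concat \<alpha> \<delta>) (walk_concat \<beta> \<delta>)" if "walk_step G x y \<alpha> \<beta>" for \<alpha> \<beta>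
    using that assms(2) homotopic_rel_endpoints_walk_concat_right prunes_to_walk_concat_right
    by (auto simp: walk_step_def walk_concat_in_walks)
qed

text \<open>The factors are changed one at a time. This is what makes composition of classes well
  defined.\<close>

lemma walk_rel_concat:
  assumes "(\<alpha>, \<alpha>') \<in> walk_rel G x y" "(\<beta>, \<beta>') \<in> walk_rel G y z"
  shows "(walk_concat \<alpha> \<beta>, walk_concat \<alpha>' \<beta>') \<in> walk_rel G x z"
  using walk_rel_concat_right[OF assms(1)] walk_rel_concat_left[OF assms(2)]
  by (meson assms walk_relD walk_rel_trans)

lemma walk_rel_map:
  assumes "pair_sym_digraph H" "graph_morphism G H f" "(\<alpha>, \<beta>) \<in> walk_rel G x y"
  shows "(map f \<alpha>, map f \<beta>) \<in> walk_rel H (f x) (f y)"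
  using homotopic_rel_endpoints_map[OF assms(2)] prunes_to_map[of _ _ f]
  by (intro walk_rel_mapI[OF _ _ assms(3)])
    (auto simp: walk_step_def map_in_walks[OF assms(1,2)])

lemma walk_rel_prune:
  assumes "p @ [a, b, a] @ q \<in> walks G x y"
  shows "(p @ [a, b, a] @ q, p @ [a] @ q) \<in> walk_rel G x y"
proof -
  have "p @ [a] @ q \<in> walks G x y"
    using assms by (auto simp: walks_iff successively_append_iff successively_Cons hd_append)
  with assms show ?thesis
    by (intro walk_step_imp_walk_rel) (auto simp: walk_step_def prunes_to_iff)
qed

lemma walk_rel_list_update:
  assumes "\<alpha> \<in> walks G x y" "\<alpha>[k := v] \<in> walks G x y" "0 < k" "k + 1 < length \<alpha>"
  shows "(\<alpha>, \<alpha>[k := v]) \<in> walk_rel G x y"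
  using homotopic_rel_endpoints_list_update[OF assms] assms(1,2)
  by (intro walk_step_imp_walk_rel) (simp add: walk_step_def)

text \<open>Induction from the inside out: the tail followed by its reversal contracts to its first
  vertex w, and the remaining walk x, w, x is removed by one prune.\<close>

lemma walk_rel_concat_rev:
  assumes "\<alpha> \<in> walks G x y"
  shows "(walk_concat \<alpha> (rev \<alpha>), [x]) \<in> walk_rel G x x"
  using assms
proof (induction \<alpha> arbitrary: x)
  case Nil
  then show ?case by (simp add: walks_iff)
next
  case IH: (Cons v \<alpha>)
  show ?case
  proof (cases \<alpha>)
    case Nil
    with IH.prems show ?thesis
      by (auto simp: walk_concat_def walks_iff intro: walk_rel_refl)
  next
    case (Cons w \<beta>)
    with IH.prems have *: "v = x" "\<alpha> \<in> walks G w y" "[x, w] \<in> walks G x w" "[w, x] \<in> walks G w x"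
      "x \<in> pverts G" "w \<in> pverts G"
      by (auto simp: walks_iff arc_sym)
    have "rev \<alpha> \<noteq> []"
      using Cons by simp
    then have "walk_concat (v # \<alpha>) (rev (v # \<alpha>)) =
        walk_concat [x, w] (walk_concat (walk_concat \<alpha> (rev \<alpha>)) [w, x])"
      using * Cons by (cases "rev \<beta>") (simp_all add: walk_concat_def)
    also have "(\<dots>, walk_concat [x, w] (walk_concat [w] [w, x])) \<in> walk_rel G x x"
      using * IH.IH[OF *(2)] by (intro walk_rel_concat_left walk_rel_concat_right)
    also have "walk_concat [x, w] (walk_concat [w] [w, x]) = [] @ [x, w, x] @ []"
      by (simp add: walk_concat_def)
    also have "(\<dots>, [] @ [x] @ []) \<in> walk_rel G x x"
      using walk_concat_in_walks[OF *(3,4)]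
      by (intro walk_rel_prune) (simp add: walk_concat_def)
    finally show ?thesis by simp
  qed
qed

end


section \<open>The fundamental groupoid\<close>

definition walk_class :: "'a pair_pre_digraph \<Rightarrow> 'a \<Rightarrow> 'a \<Rightarrow> 'a list \<Rightarrow> 'a list set" where
  "walk_class G x y \<alpha> = walk_rel G x y `` {\<alpha>}"

lemma walk_class_eqI: "(\<alpha>, \<beta>) \<in> walk_rel G x y \<Longrightarrow> walk_class G x y \<alpha> = walk_class G x y \<beta>"
  unfolding walk_class_def by (rule equiv_class_eq[OF equiv_walk_rel])

lemma mem_walk_class: "\<beta> \<in> walk_class G x y \<alpha> \<longleftrightarrow> (\<alpha>, \<beta>) \<in> walk_rel G x y"
  by (simp add: walk_class_def)

lemma Ob_fundamental_groupoid [simp]: "Ob (fundamental_groupoid G) = pverts G"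
  by (simp add: fundamental_groupoid_def)

lemma Hom_fundamental_groupoid: "Hom (fundamental_groupoid G) x y = walk_class G x y ` walks G x y"
  by (auto simp: fundamental_groupoid_def walk_class_def quotient_def)

lemma Ident_fundamental_groupoid: "Ident (fundamental_groupoid G) x = walk_class G x x [x]"
  by (simp add: fundamental_groupoid_def walk_class_def)

text \<open>All representatives contribute the same class to the union, by
  \<open>walk_rel_concat\<close>, and the index sets are nonempty because they contain \<alpha> and
  \<beta>.\<close>

lemma (in pair_sym_digraph) Comp_fundamental_groupoid:
  assumes "\<alpha> \<in> walks G x y" "\<beta> \<in> walks G y z"
  shows "Comp (fundamental_groupoid G) x y z (walk_class G y z \<beta>) (walk_class G x y \<alpha>) =
    walk_class G x z (walk_concat \<alpha> \<beta>)"
proof -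
  have "Comp (fundamental_groupoid G) x y z (walk_class G y z \<beta>) (walk_class G x y \<alpha>) =
    (\<Union>\<alpha>' \<in> walk_class G x y \<alpha>. \<Union>\<beta>' \<in> walk_class G y z \<beta>. walk_class G x z (walk_concat \<alpha>' \<beta>'))"
    by (simp add: fundamental_groupoid_def walk_class_def)
  also have "\<dots> = (\<Union>\<alpha>' \<in> walk_class G x y \<alpha>. \<Union>\<beta>' \<in> walk_class G y z \<beta>.
      walk_class G x z (walk_concat \<alpha> \<beta>))"
    by (intro SUP_cong refl walk_class_eqI walk_rel_sym[OF walk_rel_concat])
      (simp_all add: mem_walk_class)
  also have "\<dots> = walk_class G x z (walk_concat \<alpha> \<beta>)"
    using assms walk_rel_refl by (fastforce simp: mem_walk_class)
  finally show ?thesis .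
qed

context pair_sym_digraph
begin

lemma singleton_in_walks: "x \<in> pverts G \<Longrightarrow> [x] \<in> walks G x x"
  by (simp add: walks_iff)

text \<open>Concatenation of walks is strictly associative and has the walks \<open>[x]\<close> as
  strict units; the laws pass to classes through representatives.\<close>

lemma category_fundamental_groupoid: "category (fundamental_groupoid G)"
proof
  fix w x y z f g h
  assume "f \<in> Hom (fundamental_groupoid G) w x" "g \<in> Hom (fundamental_groupoid G) x y"
    "h \<in> Hom (fundamental_groupoid G) y z"
  then obtain \<alpha> \<beta> \<gamma> where *: "\<alpha> \<in> walks G w x" "\<beta> \<in> walks G x y" "\<gamma> \<in> walks G y z"
    "f = walk_class G w x \<alpha>" "g = walk_class G x y \<beta>" "h = walk_class G y z \<gamma>"
    by (auto simp: Hom_fundamental_groupoid)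
  moreover have "\<beta> \<noteq> []"
    using *(2) by (simp add: walks_iff)
  ultimately show "Comp (fundamental_groupoid G) w y z h (Comp (fundamental_groupoid G) w x y g f) =
      Comp (fundamental_groupoid G) w x z (Comp (fundamental_groupoid G) x y z h g) f"
    by (simp add: Comp_fundamental_groupoid walk_concat_in_walks walk_concat_assoc)
qed (auto simp: Hom_fundamental_groupoid Ident_fundamental_groupoid Comp_fundamental_groupoid
    singleton_in_walks walk_concat_in_walks walk_concat_singleton_left walk_concat_singleton_right)

text \<open>The inverse is the class of \<open>rev \<alpha>\<close>. The second identity is
  \<open>walk_rel_concat_rev\<close> applied to \<open>rev \<alpha>\<close>, whose reversal is
  \<alpha>. Thus any natural family of walks gives an isomorphism of functors.\<close>

lemma is_iso_walk_class:
  assumes "\<alpha> \<in> walks G x y"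
  shows "is_iso (fundamental_groupoid G) x y (walk_class G x y \<alpha>)"
proof -
  have r: "rev \<alpha> \<in> walks G y x"
    using assms by (rule rev_in_walks)
  then show ?thesis
    unfolding is_iso_def Hom_fundamental_groupoid Ident_fundamental_groupoid
    using assms walk_rel_concat_rev[OF assms] walk_rel_concat_rev[OF r]
    by (auto simp: Comp_fundamental_groupoid intro!: bexI[of _ "rev \<alpha>"] walk_class_eqI)
qed

end

section \<open>Functors induced by graph morphisms\<close>

definition induced_functor ::
  "'b pair_pre_digraph \<Rightarrow> ('a \<Rightarrow> 'b) \<Rightarrow> ('a, 'a list set, 'b, 'b list set) cat_map" where
  "induced_functor H f =
     \<lparr> on_ob = f, on_arr = (\<lambda>x y A. \<Union>\<alpha> \<in> A. walk_class H (f x) (f y) (map f \<alpha>)) \<rparr>"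

lemma on_ob_induced_functor [simp]: "on_ob (induced_functor H f) = f"
  by (simp add: induced_functor_def)

context pair_sym_digraph
begin

text \<open>The union over representatives in \<open>induced_functor\<close> avoids a choice; it
  collapses to one class since \<open>map f\<close> respects \<open>walk_rel\<close> and \<alpha>
  lies in its own class.\<close>

lemma on_arr_induced_functor:
  assumes "pair_sym_digraph H" "graph_morphism G H f" "\<alpha> \<in> walks G x y"
  shows "on_arr (induced_functor H f) x y (walk_class G x y \<alpha>) =
    walk_class H (f x) (f y) (map f \<alpha>)"
proof -
  have "on_arr (induced_functor H f) x y (walk_class G x y \<alpha>) =
      (\<Union>\<beta> \<in> walk_class G x y \<alpha>. walk_class H (f x) (f y) (map f \<alpha>))"
    unfolding induced_functor_def cat_map.simps
    by (intro SUP_cong refl walk_class_eqI walk_rel_sym[OF walk_rel_map[OF assms(1,2)]])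
      (simp add: mem_walk_class)
  also have "\<dots> = walk_class H (f x) (f y) (map f \<alpha>)"
    using assms(3) walk_rel_refl by (fastforce simp: mem_walk_class)
  finally show ?thesis .
qed

lemma is_functor_induced_functor:
  assumes "pair_sym_digraph H" "graph_morphism G H f"
  shows "is_functor (fundamental_groupoid G) (fundamental_groupoid H) (induced_functor H f)"
  unfolding is_functor_def
  using assms on_arr_induced_functor[OF assms] map_in_walks[OF assms]
  by (auto simp: Hom_fundamental_groupoid Ident_fundamental_groupoid Comp_fundamental_groupoid
      pair_sym_digraph.Comp_fundamental_groupoid[OF assms(1)]
      singleton_in_walks walk_concat_in_walks map_walk_concat graph_morphism_def)

end


section \<open>Homotopies induce natural isomorphisms\<close>

text \<open>A natural isomorphism of induced functors, given by representatives: the components are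
  walks and the naturality squares commute up to \<open>walk_rel\<close>. Such squares can be pasted
  by rebracketing lists.\<close>

definition naturally_homotopic ::
  "'a pair_pre_digraph \<Rightarrow> 'b pair_pre_digraph \<Rightarrow> ('a \<Rightarrow> 'b) \<Rightarrow> ('a \<Rightarrow> 'b) \<Rightarrow> bool" where
  "naturally_homotopic G H f g \<longleftrightarrow>
     (\<exists>h. (\<forall>v \<in> pverts G. h v \<in> walks H (f v) (g v)) \<and>
       (\<forall>x y. \<forall>\<alpha> \<in> walks G x y.
          (walk_concat (h x) (map g \<alpha>), walk_concat (map f \<alpha>) (h y)) \<in> walk_rel H (f x) (g y)))"

text \<open>F and K are constrained only by their values on vertices and on classes of walks, so
  that \<open>id_functor\<close> and composites of induced functors fit as well as induced
  functors.\<close>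

lemma natural_isomorphism_exists:
  assumes G: "pair_sym_digraph G" and H: "pair_sym_digraph H"
    and "graph_morphism G H f" "graph_morphism G H g" "naturally_homotopic G H f g"
    and F: "\<And>x. on_ob F x = f x" "\<And>x y \<alpha>. \<alpha> \<in> walks G x y \<Longrightarrow>
      on_arr F x y (walk_class G x y \<alpha>) = walk_class H (f x) (f y) (map f \<alpha>)"
    and K: "\<And>x. on_ob K x = g x" "\<And>x y \<alpha>. \<alpha> \<in> walks G x y \<Longrightarrow>
      on_arr K x y (walk_class G x y \<alpha>) = walk_class H (g x) (g y) (map g \<alpha>)"
  shows "\<exists>\<eta>. natural_isomorphism (fundamental_groupoid G) (fundamental_groupoid H) F K \<eta>"
proof -
  interpret G: pair_sym_digraph G by fact
  interpret H: pair_sym_digraph H by fact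
  obtain h where h: "\<And>v. v \<in> pverts G \<Longrightarrow> h v \<in> walks H (f v) (g v)"
    "\<And>x y \<alpha>. \<alpha> \<in> walks G x y \<Longrightarrow>
      (walk_concat (h x) (map g \<alpha>), walk_concat (map f \<alpha>) (h y)) \<in> walk_rel H (f x) (g y)"
    using assms(5) unfolding naturally_homotopic_def by blast
  have "natural_isomorphism (fundamental_groupoid G) (fundamental_groupoid H) F K
      (\<lambda>x. walk_class H (f x) (g x) (h x))"
    unfolding natural_isomorphism_def
    using h F K assms(3,4)
    by (auto simp: Hom_fundamental_groupoid H.is_iso_walk_class H.Comp_fundamental_groupoid
        G.map_in_walks[OF H] intro!: walk_class_eqI walk_rel_sym[OF h(2)])
  then show ?thesis by blast
qed

lemma naturally_homotopic_refl:
  assumes "pair_sym_digraph G" "pair_sym_digraph H" "graph_morphism G H f"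
  shows "naturally_homotopic G H f f"
proof -
  interpret G: pair_sym_digraph G by fact
  interpret H: pair_sym_digraph H by fact
  have "\<forall>v \<in> pverts G. [f v] \<in> walks H (f v) (f v)"
    using assms(3) by (auto simp: graph_morphism_def intro: H.singleton_in_walks)
  moreover have "(walk_concat [f x] (map f \<alpha>), walk_concat (map f \<alpha>) [f y]) \<in> walk_rel H (f x) (f y)"
    if "\<alpha> \<in> walks G x y" for x y \<alpha>
    using G.map_in_walks[OF assms(2,3) that]
    by (simp add: H.walk_concat_singleton_left walk_concat_singleton_right walk_rel_refl)
  ultimately show ?thesis
    unfolding naturally_homotopic_def by (intro exI[of _ "\<lambda>v. [f v]"]) blast
qed

text \<open>Vertical composition: the component at v is \<open>h v\<close> followed by
  \<open>l v\<close>, and the two naturality squares are pasted along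
  \<open>map g \<alpha>\<close>.\<close>

lemma naturally_homotopic_trans:
  assumes "pair_sym_digraph G" "pair_sym_digraph H"
    and "graph_morphism G H f" "graph_morphism G H g" "graph_morphism G H k"
    and "naturally_homotopic G H f g" "naturally_homotopic G H g k"
  shows "naturally_homotopic G H f k"
proof -
  interpret G: pair_sym_digraph G by fact
  interpret H: pair_sym_digraph H by fact
  obtain h where h: "\<And>v. v \<in> pverts G \<Longrightarrow> h v \<in> walks H (f v) (g v)"
    "\<And>x y \<alpha>. \<alpha> \<in> walks G x y \<Longrightarrow>
      (walk_concat (h x) (map g \<alpha>), walk_concat (map f \<alpha>) (h y)) \<in> walk_rel H (f x) (g y)"
    using assms(6) unfolding naturally_homotopic_def by blast
  obtain l where l: "\<And>v. v \<in> pverts G \<Longrightarrow> l v \<in> walks H (g v) (k v)"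
    "\<And>x y \<alpha>. \<alpha> \<in> walks G x y \<Longrightarrow>
      (walk_concat (l x) (map k \<alpha>), walk_concat (map g \<alpha>) (l y)) \<in> walk_rel H (g x) (k y)"
    using assms(7) unfolding naturally_homotopic_def by blast
  have "(walk_concat (walk_concat (h x) (l x)) (map k \<alpha>),
      walk_concat (map f \<alpha>) (walk_concat (h y) (l y))) \<in> walk_rel H (f x) (k y)"
    if \<alpha>: "\<alpha> \<in> walks G x y" for x y \<alpha>
  proof -
    have xy: "x \<in> pverts G" "y \<in> pverts G"
      using G.walks_ends_in_verts[OF \<alpha>] by auto
    then have ne: "l x \<noteq> []" "h y \<noteq> []" "map g \<alpha> \<noteq> []"
      using l(1)[of x] h(1)[of y] \<alpha> by (auto simp: G.walks_iff H.walks_iff)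
    have "walk_concat (walk_concat (h x) (l x)) (map k \<alpha>) =
        walk_concat (h x) (walk_concat (l x) (map k \<alpha>))"
      using ne by (simp add: walk_concat_assoc)
    also have "(\<dots>, walk_concat (h x) (walk_concat (map g \<alpha>) (l y))) \<in> walk_rel H (f x) (k y)"
      by (rule H.walk_rel_concat_left[OF l(2)[OF \<alpha>] h(1)[OF xy(1)]])
    also have "walk_concat (h x) (walk_concat (map g \<alpha>) (l y)) =
        walk_concat (walk_concat (h x) (map g \<alpha>)) (l y)"
      using ne by (simp add: walk_concat_assoc)
    also have "(\<dots>, walk_concat (walk_concat (map f \<alpha>) (h y)) (l y)) \<in> walk_rel H (f x) (k y)"
      by (rule H.walk_rel_concat_right[OF h(2)[OF \<alpha>] l(1)[OF xy(2)]])
    also have "walk_concat (walk_concat (map f \<alpha>) (h y)) (l y) =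
        walk_concat (map f \<alpha>) (walk_concat (h y) (l y))"
      using ne by (simp add: walk_concat_assoc)
    finally show ?thesis .
  qed
  then show ?thesis
    unfolding naturally_homotopic_def using H.walk_concat_in_walks[OF h(1) l(1)]
    by (intro exI[of _ "\<lambda>v. walk_concat (h v) (l v)"]) simp
qed

text \<open>Adjacency of f and g in the exponential graph of maps from G to H, where the morphisms
  are the looped vertices. Consecutive slices of a homotopy are related in this way.\<close>

definition times_adjacent ::
  "'a pair_pre_digraph \<Rightarrow> 'b pair_pre_digraph \<Rightarrow> ('a \<Rightarrow> 'b) \<Rightarrow> ('a \<Rightarrow> 'b) \<Rightarrow> bool" where
  "times_adjacent G H f g \<longleftrightarrow>
     graph_morphism G H f \<and> graph_morphism G H g \<and>
     (\<forall>v w. (v, w) \<in> parcs G \<longrightarrow> (f v, g w) \<in> parcs H)"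

text \<open>Reversing the arc first in G and then in H exchanges the roles of f and g.\<close>

lemma times_adjacent_sym:
  assumes "pair_sym_digraph G" "pair_sym_digraph H" "times_adjacent G H f g"
  shows "times_adjacent G H g f"
  using assms pair_sym_digraph.arc_sym unfolding times_adjacent_def by metis

text \<open>Isolated vertices are excluded because the component at \<open>v\<close> runs through a neighbour of \<open>v\<close>.\<close>

lemma times_adjacent_imp_naturally_homotopic:
  assumes "pair_sym_digraph G" "pair_sym_digraph H"
    and nbr: "\<And>v. v \<in> pverts G \<Longrightarrow> \<exists>w. (v, w) \<in> parcs G"
    and "times_adjacent G H f g"
  shows "naturally_homotopic G H f g"
proof -
  interpret G: pair_sym_digraph G by fact
  interpret H: pair_sym_digraph H by fact
  have f: "graph_morphism G H f" and g: "graph_morphism G H g"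
    using assms(4) by (auto simp: times_adjacent_def)
  have verts: "f v \<in> pverts H" "g v \<in> pverts H" if "v \<in> pverts G" for v
    using f g that by (auto simp: graph_morphism_def)
  have arcs: "(f v, f w) \<in> parcs H" "(g v, g w) \<in> parcs H" "(f v, g w) \<in> parcs H"
    if "(v, w) \<in> parcs G" for v w
    using assms(4) that by (auto simp: times_adjacent_def graph_morphism_def)
  obtain nb where nb: "\<And>v. v \<in> pverts G \<Longrightarrow> (v, nb v) \<in> parcs G"
    using nbr by metis
  have nb_verts: "nb v \<in> pverts G" if "v \<in> pverts G" for v
    using nb[OF that] by (rule G.in_arcsD2)
  \<comment> \<open>The vertices \<open>f v\<close> and \<open>g v\<close> need not be adjacent, but
    \<open>f (nb v)\<close> is adjacent to both: to \<open>f v\<close> because f is a morphism, to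
    \<open>g v\<close> because \<open>nb v\<close> is adjacent to v.\<close>
  define h where "h = (\<lambda>v. [f v, f (nb v), g v])"
  have h: "h v \<in> walks H (f v) (g v)" if "v \<in> pverts G" for v
    using that nb[OF that] nb_verts[OF that] verts arcs
      G.arc_sym[OF nb[OF that]]
    by (auto simp: h_def H.walks_iff)
  \<comment> \<open>Both sides of the square over one edge have length three and differ in the two
    interior vertices. They are changed in turn, through the walk
    \<open>[f v, f w, g v, g w]\<close>, which exists since w is a neighbour of v.\<close>
  have edge: "(walk_concat (h v) [g v, g w], walk_concat [f v, f w] (h w)) \<in> walk_rel H (f v) (g w)"
    if vw: "(v, w) \<in> parcs G" for v w
  proof -
    have wv: "(w, v) \<in> parcs G" and v: "v \<in> pverts G" and w: "w \<in> pverts G"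
      using vw by (auto intro: G.arc_sym G.in_arcsD1 G.in_arcsD2)
    have W: "[f v, f a, g v, g w] \<in> walks H (f v) (g w)" if "(v, a) \<in> parcs G" for a
      using that G.arc_sym[OF that] G.in_arcsD2[OF that] v w vw verts arcs
      by (auto simp: H.walks_iff)
    have W': "[f v, f w, f a, g w] \<in> walks H (f v) (g w)" if "(w, a) \<in> parcs G" for a
      using that G.arc_sym[OF that] G.in_arcsD2[OF that] v w vw verts arcs
      by (auto simp: H.walks_iff)
    have "walk_concat (h v) [g v, g w] = [f v, f (nb v), g v, g w]"
      by (simp add: h_def walk_concat_def)
    also have "(\<dots>, [f v, f w, g v, g w]) \<in> walk_rel H (f v) (g w)"
      using H.walk_rel_list_update[OF W[OF nb[OF v]], of 1 "f w"] W[OF vw] by simp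
    also have "([f v, f w, g v, g w], [f v, f w, f (nb w), g w]) \<in> walk_rel H (f v) (g w)"
      using H.walk_rel_list_update[OF W[OF vw], of 2 "f (nb w)"] W'[OF nb[OF w]] by simp
    also have "[f v, f w, f (nb w), g w] = walk_concat [f v, f w] (h w)"
      by (simp add: h_def walk_concat_def)
    finally show ?thesis .
  qed
  \<comment> \<open>Induction over the edges: \<open>edge\<close> moves the component past the first
    edge, and the induction hypothesis moves it past the rest, which starts at another vertex; hence
    x is arbitrary.\<close>
  have "(walk_concat (h x) (map g \<alpha>), walk_concat (map f \<alpha>) (h y)) \<in> walk_rel H (f x) (g y)"
    if "\<alpha> \<in> walks G x y" for x y \<alpha>
    using that
  proof (induction \<alpha> arbitrary: x)
    case Nil
    then show ?case by (simp add: G.walks_iff)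
  next
    case IH: (Cons v \<alpha>)
    show ?case
    proof (cases \<alpha>)
      case Nil
      with IH.prems have "v = x" "y = x" "x \<in> pverts G"
        by (auto simp: G.walks_iff)
      then show ?thesis
        using Nil h[of x]
        by (simp add: walk_concat_singleton_right H.walk_concat_singleton_left walk_rel_refl)
    next
      case (Cons w \<beta>)
      with IH.prems have *: "v = x" "\<alpha> \<in> walks G w y" "(x, w) \<in> parcs G"
        "x \<in> pverts G" "w \<in> pverts G"
        by (auto simp: G.walks_iff)
      have "walk_concat (h x) (map g (v # \<alpha>)) = walk_concat (walk_concat (h x) [g x, g w]) (map g \<alpha>)"
        using * Cons by (simp add: walk_concat_def)
      also have "(\<dots>, walk_concat (walk_concat [f x, f w] (h w)) (map g \<alpha>)) \<in> walk_rel H (f x) (g y)"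
        by (rule H.walk_rel_concat_right[OF edge[OF *(3)] G.map_in_walks[OF assms(2) g *(2)]])
      also have "walk_concat (walk_concat [f x, f w] (h w)) (map g \<alpha>) =
          walk_concat [f x, f w] (walk_concat (h w) (map g \<alpha>))"
        by (simp add: walk_concat_assoc h_def)
      also have "(\<dots>, walk_concat [f x, f w] (walk_concat (map f \<alpha>) (h y))) \<in> walk_rel H (f x) (g y)"
        using * verts arcs
        by (intro H.walk_rel_concat_left[OF IH.IH[OF *(2)]]) (simp add: H.walks_iff)
      also have "walk_concat [f x, f w] (walk_concat (map f \<alpha>) (h y)) =
          walk_concat (map f (v # \<alpha>)) (h y)"
        using * Cons by (simp add: walk_concat_def)
      finally show ?thesis .
    qed
  qed
  then show ?thesis
    unfolding naturally_homotopic_def using h by blast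
qed

text \<open>The homotopy is cut into its time slices: the loops of \<open>looped_path_graph\<close>
  make each slice a morphism, and its other edges make consecutive slices adjacent.\<close>

lemma times_homotopic_imp_rtranclp_times_adjacent:
  assumes "pair_sym_digraph G" "times_homotopic G H f g"
  shows "(times_adjacent G H)\<^sup>*\<^sup>* f g"
proof -
  interpret G: pair_sym_digraph G by fact
  obtain n \<Lambda> where \<Lambda>: "graph_morphism (G \<times>\<^sub>g looped_path_graph n) H \<Lambda>"
    "\<And>v. v \<in> pverts G \<Longrightarrow> \<Lambda> (v, 0) = f v" "\<And>v. v \<in> pverts G \<Longrightarrow> \<Lambda> (v, n) = g v"
    and f: "graph_morphism G H f" and g: "graph_morphism G H g"
    using assms(2) unfolding times_homotopic_def by blast
  have arc: "(\<Lambda> (v, i), \<Lambda> (w, j)) \<in> parcs H"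
    if "(v, w) \<in> parcs G" "i \<le> n" "j \<le> n" "j = i \<or> j = i + 1" for v w i j
    using \<Lambda>(1) that unfolding graph_morphism_def graph_prod_def looped_path_graph_def by auto
  have mor: "graph_morphism G H (\<lambda>v. \<Lambda> (v, i))" if "i \<le> n" for i
    using arc that \<Lambda>(1) unfolding graph_morphism_def graph_prod_def looped_path_graph_def by auto
  have "(times_adjacent G H)\<^sup>*\<^sup>* f (\<lambda>v. \<Lambda> (v, i))" if "i \<le> n" for i
    using that
  proof (induction i)
    case 0
    \<comment> \<open>Slice 0 equals f only on vertices, so as total functions they may differ. A
      step of \<open>times_adjacent\<close> replaces the equality here, and likewise between slice n
      and g at the other end.\<close>
    have "(f v, \<Lambda> (w, 0)) \<in> parcs H" if "(v, w) \<in> parcs G" for v w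
      using arc[OF that, of 0 0] \<Lambda>(2)[of v] G.in_arcsD1[OF that] by simp
    then have "times_adjacent G H f (\<lambda>v. \<Lambda> (v, 0))"
      using f mor by (simp add: times_adjacent_def)
    then show ?case by (rule r_into_rtranclp[of "times_adjacent G H"])
  next
    case (Suc i)
    then have "times_adjacent G H (\<lambda>v. \<Lambda> (v, i)) (\<lambda>v. \<Lambda> (v, Suc i))"
      using mor arc by (simp add: times_adjacent_def)
    with Suc show ?case
      by (metis (mono_tags, lifting) Suc_leD rtranclp.rtrancl_into_rtrancl)
  qed
  moreover have "times_adjacent G H (\<lambda>v. \<Lambda> (v, n)) g"
  proof -
    have "(\<Lambda> (v, n), g w) \<in> parcs H" if "(v, w) \<in> parcs G" for v w
      using arc[OF that, of n n] \<Lambda>(3)[of w] G.in_arcsD2[OF that] by simp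
    then show ?thesis
      using g mor by (simp add: times_adjacent_def)
  qed
  ultimately show ?thesis
    by (meson order_refl rtranclp.rtrancl_into_rtrancl)
qed

lemma rtranclp_times_adjacent_imp_naturally_homotopic:
  assumes "pair_sym_digraph G" "pair_sym_digraph H"
    and "\<And>v. v \<in> pverts G \<Longrightarrow> \<exists>w. (v, w) \<in> parcs G"
    and "graph_morphism G H f" "(times_adjacent G H)\<^sup>*\<^sup>* f g"
  shows "naturally_homotopic G H f g"
  using assms(5)
proof (induction rule: rtranclp_induct)
  case base
  show ?case using assms(1,2,4) by (rule naturally_homotopic_refl)
next
  case (step g k)
  then have "graph_morphism G H g" "graph_morphism G H k"
    by (auto simp: times_adjacent_def)
  with step show ?case
    using naturally_homotopic_trans[OF assms(1,2,4)]
      times_adjacent_imp_naturally_homotopic[OF assms(1-3)] by blast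
qed

text \<open>The chain of adjacent morphisms can be run backwards, so one homotopy yields components
  in either direction.\<close>

lemma times_homotopic_imp_naturally_homotopic:
  assumes "pair_sym_digraph G" "pair_sym_digraph H"
    and "\<And>v. v \<in> pverts G \<Longrightarrow> \<exists>w. (v, w) \<in> parcs G"
    and "times_homotopic G H f g"
  shows "naturally_homotopic G H f g" "naturally_homotopic G H g f"
proof -
  have "symp (times_adjacent G H)"
    using times_adjacent_sym[OF assms(1,2)] by (rule sympI)
  then have "symp (times_adjacent G H)\<^sup>*\<^sup>*"
    by (rule symp_rtranclp)
  with times_homotopic_imp_rtranclp_times_adjacent[OF assms(1,4)]
  show "naturally_homotopic G H f g" "naturally_homotopic G H g f"
    using assms(4) rtranclp_times_adjacent_imp_naturally_homotopic[OF assms(1-3)]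
    by (auto simp: times_homotopic_def dest: sympD)
qed

section \<open>Assembling the equivalence of groupoids\<close>

lemma graph_morphism_comp:
  "graph_morphism G H f \<Longrightarrow> graph_morphism H K g \<Longrightarrow> graph_morphism G K (g \<circ> f)"
  by (simp add: graph_morphism_def)

lemma graph_morphism_id: "graph_morphism G G id"
  by (simp add: graph_morphism_def)

lemma on_arr_comp_induced_functor:
  assumes "pair_sym_digraph G" "pair_sym_digraph H" "pair_sym_digraph K"
    and "graph_morphism G H f" "graph_morphism H K g" "\<alpha> \<in> walks G x y"
  shows "on_arr (comp_functor (induced_functor K g) (induced_functor H f)) x y (walk_class G x y \<alpha>) =
    walk_class K ((g \<circ> f) x) ((g \<circ> f) y) (map (g \<circ> f) \<alpha>)"
  using assms
  by (simp add: comp_functor_def pair_sym_digraph.on_arr_induced_functor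
      pair_sym_digraph.map_in_walks)

theorem corollary4p9:
  fixes G :: "'a pair_pre_digraph" and H :: "'b pair_pre_digraph"
  assumes "pair_pseudo_graph G" and "pair_pseudo_graph H"
    and "\<forall>v \<in> pverts G. \<not> isolated G v"
    and "\<forall>v \<in> pverts H. \<not> isolated H v"
    and "times_homotopy_equivalent G H"
  shows "equivalent_categories (fundamental_groupoid G) (fundamental_groupoid H)"
proof -
  have G: "pair_sym_digraph G" and H: "pair_sym_digraph H"
    using assms(1,2) by (simp_all add: pair_pseudo_graph_def)
  have nbr: "\<And>v. v \<in> pverts G \<Longrightarrow> \<exists>w. (v, w) \<in> parcs G"
    "\<And>v. v \<in> pverts H \<Longrightarrow> \<exists>w. (v, w) \<in> parcs H"
    using assms(3,4) by (auto simp: isolated_def)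
  obtain \<phi> \<psi> where \<phi>: "graph_morphism G H \<phi>" and \<psi>: "graph_morphism H G \<psi>"
    and hom: "times_homotopic G G (\<psi> \<circ> \<phi>) id" "times_homotopic H H (\<phi> \<circ> \<psi>) id"
    using assms(5) unfolding times_homotopy_equivalent_def by blast
  let ?F = "induced_functor H \<phi>" and ?K = "induced_functor G \<psi>"
  \<comment> \<open>The unit of the equivalence starts at the identity, whereas the homotopy ends
    there; hence the reversed direction here and the direct one for the counit.\<close>
  have "\<exists>\<eta>. natural_isomorphism (fundamental_groupoid G) (fundamental_groupoid G)
      id_functor (comp_functor ?K ?F) \<eta>"
    by (rule natural_isomorphism_exists[OF G G graph_morphism_id graph_morphism_comp[OF \<phi> \<psi>]
          times_homotopic_imp_naturally_homotopic(2)[OF G G nbr(1) hom(1)]])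
      (simp_all only: on_arr_comp_induced_functor[OF G H G \<phi> \<psi>],
        simp_all add: id_functor_def comp_functor_def)
  moreover have "\<exists>\<epsilon>. natural_isomorphism (fundamental_groupoid H) (fundamental_groupoid H)
      (comp_functor ?F ?K) id_functor \<epsilon>"
    by (rule natural_isomorphism_exists[OF H H graph_morphism_comp[OF \<psi> \<phi>] graph_morphism_id
          times_homotopic_imp_naturally_homotopic(1)[OF H H nbr(2) hom(2)]])
      (simp_all only: on_arr_comp_induced_functor[OF H G H \<psi> \<phi>],
        simp_all add: id_functor_def comp_functor_def)
  ultimately show ?thesis
    unfolding equivalent_categories_def
    using pair_sym_digraph.category_fundamental_groupoid[OF G]
      pair_sym_digraph.category_fundamental_groupoid[OF H]
      pair_sym_digraph.is_functor_induced_functor[OF G H \<phi>]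
      pair_sym_digraph.is_functor_induced_functor[OF H G \<psi>]
    by blast
qed

end
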